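(* Let $\lambda>0$, $\sigma>0$, let $X$ be a real $n\times p$ matrix, $Y\in\mathbb{R}^n$, and let $$\hat\beta(\sigma):=\arg\min_{\beta\in\mathbb{R}^p}\Big\{\|Y-X\beta\|_n^2+2\lambda\sigma\|\beta\|_1\Big\}.$$ Define $$\tilde\sigma^2(\sigma):=\|Y-X\hat\beta(\sigma)\|_n^2+\lambda\sigma\|\hat\beta(\sigma)\|_1 .$$ Then $$\tilde\sigma^2(\sigma)=Y^T(Y-X\hat\beta(\sigma))/n .$$
   Context: For $v\in\mathbb{R}^n$, $\|v\|_n:=\sqrt{v^Tv/n}$; $\|\cdot\|_1$ is the $\ell_1$-norm. $\hat\beta(\sigma)$ denotes any minimizer. *)

theory Defs
  imports "HOL-Analysis.Analysis"
begin

definition norm_n :: "real ^ 'n \<Rightarrow> real" where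
  "norm_n v = sqrt ((v \<bullet> v) / real CARD('n))"

definition norm_l1 :: "real ^ 'p \<Rightarrow> real" where
  "norm_l1 b = (\<Sum>j\<in>UNIV. \<bar>b $ j\<bar>)"

definition lasso_objective ::
  "real \<Rightarrow> real ^ 'p ^ 'n \<Rightarrow> real ^ 'n \<Rightarrow> real \<Rightarrow> real ^ 'p \<Rightarrow> real" where
  "lasso_objective lam X Y \<sigma> b = (norm_n (Y - X *v b))\<^sup>2 + 2 * lam * \<sigma> * norm_l1 b"

text \<open>Lasso minimizers need not be unique, so minimality is a predicate on vectors.\<close>

definition is_lasso ::
  "real \<Rightarrow> real ^ 'p ^ 'n \<Rightarrow> real ^ 'n \<Rightarrow> real \<Rightarrow> real ^ 'p \<Rightarrow> bool" where
  "is_lasso lam X Y \<sigma> b \<longleftrightarrow> is_arg_min (lasso_objective lam X Y \<sigma>) (\<lambda>_. True) b"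

text \<open>The quantity \<open>\<sigma>~\<^sup>2(\<sigma>)\<close>, with the chosen minimizer passed explicitly as \<open>b\<close>.\<close>

definition sigma_tilde_sq ::
  "real \<Rightarrow> real ^ 'p ^ 'n \<Rightarrow> real ^ 'n \<Rightarrow> real \<Rightarrow> real ^ 'p \<Rightarrow> real" where
  "sigma_tilde_sq lam X Y \<sigma> b = (norm_n (Y - X *v b))\<^sup>2 + lam * \<sigma> * norm_l1 b"

end

theory Submission
  imports Defs
begin

text \<open>A minimizer \<open>b\<close> also minimizes the objective along the ray \<open>t b\<close>, \<open>t > 0\<close>. There the
  \<open>\<ell>\<^sub>1\<close>-norm is linear in \<open>t\<close>, so the objective is differentiable despite the penalty, and its
  derivative vanishes at \<open>t = 1\<close>: \<open>Y\<^sup>T X b / n = \<parallel>X b\<parallel>\<^sub>n\<^sup>2 + \<lambda> \<sigma> \<parallel>b\<parallel>\<^sub>1\<close>. Substituting this into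
  the expanded square gives the identity.\<close>

lemma norm_n_squared:
  fixes v :: "real ^ 'n"
  shows "(norm_n v)\<^sup>2 = (v \<bullet> v) / real CARD('n)"
  by (simp add: norm_n_def)

lemma norm_n_diff_squared:
  fixes u v :: "real ^ 'n"
  shows "(norm_n (u - v))\<^sup>2 = (norm_n u)\<^sup>2 - 2 * ((u \<bullet> v) / real CARD('n)) + (norm_n v)\<^sup>2"
  by (simp add: norm_n_squared inner_diff inner_commute diff_divide_distrib add_divide_distrib)

lemma norm_n_scaleR_squared: "(norm_n (t *\<^sub>R v))\<^sup>2 = t\<^sup>2 * (norm_n v)\<^sup>2"
  unfolding norm_n_squared by (simp add: power2_eq_square)

lemma norm_l1_scaleR: "norm_l1 (t *\<^sub>R b) = \<bar>t\<bar> * norm_l1 b"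
  by (simp add: norm_l1_def abs_mult sum_distrib_left)

lemma lasso_objective_scaleR:
  fixes X :: "real ^ 'p ^ 'n"
  assumes "t \<ge> 0"
  shows "lasso_objective lam X Y \<sigma> (t *\<^sub>R b) =
    (norm_n Y)\<^sup>2 - 2 * t * ((Y \<bullet> (X *v b)) / real CARD('n)) + t\<^sup>2 * (norm_n (X *v b))\<^sup>2
      + 2 * lam * \<sigma> * t * norm_l1 b"
  using assms
  by (simp add: lasso_objective_def norm_n_diff_squared matrix_vector_mult_scaleR
      norm_n_scaleR_squared norm_l1_scaleR)

lemma is_lasso_scaling_stationarity:
  fixes X :: "real ^ 'p ^ 'n"
  assumes "is_lasso lam X Y \<sigma> b"
  shows "(Y \<bullet> (X *v b)) / real CARD('n) = (norm_n (X *v b))\<^sup>2 + lam * \<sigma> * norm_l1 b"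
proof -
  define B where "B = (Y \<bullet> (X *v b)) / real CARD('n)"
  define C where "C = (norm_n (X *v b))\<^sup>2"
  define L where "L = norm_l1 b"
  \<comment> \<open>The penalty enters with \<open>t\<close> in place of
    \<open>\<bar>t\<bar>\<close>, so \<open>g\<close> is a polynomial on all of the reals and agrees
    with the objective along the ray for \<open>t \<ge> 0\<close>.\<close>
  define g where "g t = (norm_n Y)\<^sup>2 - 2 * t * B + t\<^sup>2 * C + 2 * lam * \<sigma> * t * L" for t
  have g: "g t = lasso_objective lam X Y \<sigma> (t *\<^sub>R b)" if "t \<ge> 0" for t
    using that by (simp add: g_def B_def C_def L_def lasso_objective_scaleR)
  \<comment> \<open>Radius 1 around \<open>t = 1\<close> keeps \<open>t\<close> positive, where
    \<open>g t\<close> is the objective at a competitor of \<open>b\<close>.\<close>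
  have "g 1 \<le> g t" if "\<bar>1 - t\<bar> < 1" for t
    using assms that by (simp add: g is_lasso_def is_arg_min_linorder)
  moreover have "(g has_real_derivative (- 2 * B + 2 * C + 2 * lam * \<sigma> * L)) (at 1)"
    unfolding g_def by (auto intro!: derivative_eq_intros)
  ultimately have "- 2 * B + 2 * C + 2 * lam * \<sigma> * L = 0"
    by (intro DERIV_local_min[where d = 1 and x = 1 and f = g]) auto
  then show ?thesis
    by (simp add: B_def C_def L_def)
qed

theorem lemma1p5p1:
  fixes X :: "real ^ 'p ^ 'n" and Y :: "real ^ 'n"
    and lam \<sigma> :: real and \<beta>hat :: "real ^ 'p"
  assumes "lam > 0" and "\<sigma> > 0"
    and "is_lasso lam X Y \<sigma> \<beta>hat"
  shows "sigma_tilde_sq lam X Y \<sigma> \<beta>hat = (Y \<bullet> (Y - X *v \<beta>hat)) / real CARD('n)"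
proof -
  \<comment> \<open>The expanded square has the cross term twice; by stationarity one copy cancels
    the fit and penalty terms.\<close>
  have "sigma_tilde_sq lam X Y \<sigma> \<beta>hat
      = (norm_n Y)\<^sup>2 - (Y \<bullet> (X *v \<beta>hat)) / real CARD('n)"
    using is_lasso_scaling_stationarity[OF assms(3)]
    by (simp add: sigma_tilde_sq_def norm_n_diff_squared)
  then show ?thesis
    by (simp add: norm_n_squared inner_diff_right diff_divide_distrib)
qed

end
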